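(* Let the setting be as in the context: data process $(Z_n)_{n\in\mathbb{N}}$ with values in a metric space $\mathcal{Z}$, parameter space $\Theta$, decision space $\mathcal{X}$, continuous function $g:\mathcal{X}\times\Theta\to\mathbb{R}$ with $x\mapsto g(x,\theta)$ strictly convex for all $\theta\in\Theta$, penalty function $\ell$, and constant $r>0$. Suppose that for each $\theta\in\Theta$ the asymptotic risk measure $\phi_\theta$ and the rate function $\mathcal{I}$ satisfy the Laplace principle $$\phi_\theta[(f(Z_n))_{n\in\mathbb{N}}]=\sup_{z\in\mathcal{Z}}\{f(z)-\mathcal{I}_\theta(z)\}\qquad\text{for all } f\in\mathcal{C}(\mathcal{Z}),\ \theta\in\Theta,$$ and that $\mathcal{I}:\Theta\times\mathcal{Z}\to[0,\infty]$ satisfies the regularity conditions (I), (II), (III) listed in the context. Suppose in addition that the function $\theta\mapsto g(x,\theta)-\ell^{-1}(\mathcal{I}_\theta(z)-r)$, with values in $[-\infty,\infty)$, is concave on $\Theta$ for all $x\in\mathcal{X}$, $z\in\mathcal{Z}$. Define $$G(x,z)=\max_{\theta\in\Theta}\{g(x,\theta)-\ell^{-1}(\mathcal{I}_\theta(z)-r)\},\qquad (x,z)\in\mathcal{X}\times\mathcal{Z}.$$ Call $H$ feasible if $H\in\mathcal{C}(\mathcal{X}\times\mathcal{Z})$ and $$\phi_\theta\Big[\Big(\ell\big(\min_{x\in\mathcal{X}}g(x,\theta)-\min_{x\in\mathcal{X}}H(x,Z_n)\big)\Big)_{n\in\mathbb{N}}\Big]\le -r\qquad\text{for all }\theta\in\Theta.$$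 Then: (a) $G$ is feasible. (b) $G$ is optimal, i.e. for every other feasible $H$, $$\min_{x\in\mathcal{X}}G(x,z)\le\min_{x\in\mathcal{X}}H(x,z)\qquad\text{for all }z\in\mathcal{Z}.$$
   Context: Setting. $\mathcal{Z}$ is a non-empty metric space. $\Theta$ and $\mathcal{X}$ are non-empty, metric, compact and convex (i.e. compact convex subsets of real topological vector spaces whose subspace topologies are metrizable). For each $\theta\in\Theta$, $(Z_n)_{n\in\mathbb{N}}$ is a sequence of $\mathcal{Z}$-valued random variables on a probability space $(\Omega,\mathcal{F},\mathbb{P}_\theta)$. $\mathcal{C}(A)$ denotes the continuous functions $A\to\mathbb{R}$. Penalty. $\ell:\mathbb{R}\to\mathbb{R}$ is an increasing continuous bijection with $\ell(0)=0$, extended by $\ell(\pm\infty)=\pm\infty$; $\ell^{-1}:[-\infty,\infty]\to[-\infty,\infty]$ is its inverse. $r>0$ is a fixed real number. Asymptotic risk measure. For each $\theta\in\Theta$, $\phi_\theta$ is a functional assigning to each sequence $(f(Z_n))_{n\in\mathbb{N}}$ with $f\in\mathcal{C}(\mathcal{Z})$ a value in $[-\infty,\infty]$. Rate function. $\mathcal{I}:\Theta\times\mathcal{Z}\to[0,\infty]$, $(\theta,z)\mapsto\mathcal{I}_\theta(z)$. Regularity conditions: (I) for every $z\in\mathcal{Z}$ there is $\theta\in\Theta$ with $\mathcal{I}_\theta(z)<\infty$; (II) $\mathcal{I}$ is lower semicontinuous on $\Theta\times\mathcal{Z}$; (III) for every $(\theta,z)\in\Theta\times\mathcal{Z}$ with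 $\mathcal{I}_\theta(z)<\infty$ and every sequence $(z_n)\subseteq\mathcal{Z}$ with $z_n\to z$ there is a sequence $(\theta_n)\subseteq\Theta$ with $\theta_n\to\theta$ and $\mathcal{I}_{\theta_n}(z_n)\to\mathcal{I}_\theta(z)$. *)

theory Defs
  imports "HOL-Probability.Probability"
begin

text \<open>Real topological vector spaces. No separation axiom is imposed; the sets considered later
  are metrizable, hence Hausdorff, in the subspace topology.\<close>

class real_topological_vector = topological_ab_group_add + real_vector +
  assumes tendsto_scaleR_Pair:
    "filterlim (\<lambda>p. fst p *\<^sub>R snd p) (nhds (c *\<^sub>R a)) (nhds c \<times>\<^sub>F nhds a)"

instance real_normed_vector \<subseteq> real_topological_vector
proof
  fix c :: real and a :: 'a
  have "((\<lambda>p. fst p *\<^sub>R snd p) \<longlongrightarrow> fst (c, a) *\<^sub>R snd (c, a)) (nhds (c, a))"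
    by (intro tendsto_intros filterlim_ident)
  then show "filterlim (\<lambda>p. fst p *\<^sub>R snd p) (nhds (c *\<^sub>R a)) (nhds c \<times>\<^sub>F nhds a)"
    by (simp add: nhds_prod)
qed

definition metrizable_compact_convex :: "'a::real_topological_vector set \<Rightarrow> bool" where
  "metrizable_compact_convex S \<longleftrightarrow>
     S \<noteq> {} \<and> metrizable_space (top_of_set S) \<and> compact S \<and> convex S"

text \<open>The minimum and maximum of a function over a possibly infinite set, when attained
  (\<open>Min\<close> and \<open>Max\<close> are restricted to finite sets).\<close>

definition min_over :: "'a set \<Rightarrow> ('a \<Rightarrow> 'b::linorder) \<Rightarrow> 'b" where
  "min_over S f = (LEAST y. y \<in> f ` S)"

definition max_over :: "'a set \<Rightarrow> ('a \<Rightarrow> 'b::linorder) \<Rightarrow> 'b" where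
  "max_over S f = (GREATEST y. y \<in> f ` S)"

definition attains_max_over :: "'a set \<Rightarrow> ('a \<Rightarrow> 'b::linorder) \<Rightarrow> bool" where
  "attains_max_over S f \<longleftrightarrow> (\<exists>x\<in>S. \<forall>y\<in>S. f y \<le> f x)"

definition strictly_convex_on :: "'a::real_vector set \<Rightarrow> ('a \<Rightarrow> real) \<Rightarrow> bool" where
  "strictly_convex_on S f \<longleftrightarrow> convex S \<and>
     (\<forall>x\<in>S. \<forall>y\<in>S. \<forall>u v. x \<noteq> y \<longrightarrow> 0 < u \<longrightarrow> 0 < v \<longrightarrow> u + v = 1 \<longrightarrow>
        f (u *\<^sub>R x + v *\<^sub>R y) < u * f x + v * f y)"

text \<open>Concavity for functions with values in \<open>[-\<infinity>,\<infinity>)\<close>. With strictly positive weights the right-hand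
  side is \<open>-\<infinity>\<close> as soon as \<open>f\<close> is \<open>-\<infinity>\<close> at one of the two points.\<close>

definition ereal_concave_on :: "'a::real_vector set \<Rightarrow> ('a \<Rightarrow> ereal) \<Rightarrow> bool" where
  "ereal_concave_on S f \<longleftrightarrow> convex S \<and> (\<forall>x\<in>S. f x < \<infinity>) \<and>
     (\<forall>x\<in>S. \<forall>y\<in>S. \<forall>u v. 0 < u \<longrightarrow> 0 < v \<longrightarrow> u + v = 1 \<longrightarrow>
        ereal u * f x + ereal v * f y \<le> f (u *\<^sub>R x + v *\<^sub>R y))"

definition lsc_on :: "'a::topological_space set \<Rightarrow> ('a \<Rightarrow> ereal) \<Rightarrow> bool" where
  "lsc_on S f \<longleftrightarrow> (\<forall>x\<in>S. \<forall>c. c < f x \<longrightarrow> (\<forall>\<^sub>F y in at x within S. c < f y))"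

definition penalty :: "(real \<Rightarrow> real) \<Rightarrow> bool" where
  "penalty l \<longleftrightarrow> strict_mono l \<and> continuous_on UNIV l \<and> bij l \<and> l 0 = 0"

function penalty_ext :: "(real \<Rightarrow> real) \<Rightarrow> ereal \<Rightarrow> ereal" where
  "penalty_ext l (ereal y) = ereal (l y)"
| "penalty_ext l \<infinity> = \<infinity>"
| "penalty_ext l (-\<infinity>) = -\<infinity>"
proof -
  fix Q and p :: "(real \<Rightarrow> real) \<times> ereal"
  assume "\<And>l y. p = (l, ereal y) \<Longrightarrow> Q" "\<And>l. p = (l, \<infinity>) \<Longrightarrow> Q" "\<And>l. p = (l, -\<infinity>) \<Longrightarrow> Q"
  then show Q by (cases p; cases "snd p") simp_all
qed simp_all
termination by standard (rule wf_on_bot)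

definition penalty_inv :: "(real \<Rightarrow> real) \<Rightarrow> ereal \<Rightarrow> ereal" where
  "penalty_inv l = inv (penalty_ext l)"

definition penalized ::
    "('x \<Rightarrow> 't \<Rightarrow> real) \<Rightarrow> (real \<Rightarrow> real) \<Rightarrow> ('t \<Rightarrow> 'z \<Rightarrow> ereal) \<Rightarrow> real \<Rightarrow> 'x \<Rightarrow> 'z \<Rightarrow> 't \<Rightarrow> ereal" where
  "penalized g l I r x z \<theta> = ereal (g x \<theta>) - penalty_inv l (I \<theta> z - ereal r)"

definition feasible ::
    "'x::topological_space set \<Rightarrow> 't set \<Rightarrow> ('x \<Rightarrow> 't \<Rightarrow> real) \<Rightarrow> (real \<Rightarrow> real) \<Rightarrow> real \<Rightarrow>
     (nat \<Rightarrow> 'w \<Rightarrow> 'z::metric_space) \<Rightarrow> ('t \<Rightarrow> (nat \<Rightarrow> 'w \<Rightarrow> real) \<Rightarrow> ereal) \<Rightarrow>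
     ('x \<Rightarrow> 'z \<Rightarrow> real) \<Rightarrow> bool" where
  "feasible X \<Theta> g l r Z \<phi> H \<longleftrightarrow>
     continuous_on (X \<times> UNIV) (\<lambda>(x, z). H x z) \<and>
     (\<forall>\<theta>\<in>\<Theta>. \<phi> \<theta> (\<lambda>n \<omega>. l (min_over X (\<lambda>x. g x \<theta>) - min_over X (\<lambda>x. H x (Z n \<omega>))))
        \<le> - ereal r)"

end

theory Submission
  imports Defs
begin

text \<open>By the Laplace principle, the risk constraint at \<open>\<theta>\<close> on \<open>H\<close> says that for every \<open>z\<close> the minimum over
  \<open>x\<close> of the penalized function at \<open>\<theta>\<close> is at most \<open>min\<^sub>x H x z\<close>. This holds for \<open>G\<close>, which dominates
  the penalized function; continuity of \<open>G\<close> is Berge's theorem, lower semicontinuity of \<open>I\<close> giving upper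
  semicontinuity and the recovery sequences giving lower semicontinuity. Optimality is the minimax
  equality: if \<open>max\<^sub>\<theta> min\<^sub>x\<close> of the penalized function is at most \<open>min\<^sub>x H x z\<close>, then so is
  \<open>min\<^sub>x max\<^sub>\<theta>\<close>, which is \<open>min\<^sub>x G x z\<close>.\<close>

section \<open>Attained extrema, compactness and semicontinuity\<close>

lemma min_over_eqI:
  assumes "x \<in> S" "\<And>y. y \<in> S \<Longrightarrow> f x \<le> f y"
  shows "min_over S f = f x"
  unfolding min_over_def using assms by (intro Least_equality) auto

lemma max_over_eqI:
  assumes "x \<in> S" "\<And>y. y \<in> S \<Longrightarrow> f y \<le> f x"
  shows "max_over S f = f x"
  unfolding max_over_def using assms by (intro Greatest_equality) auto

lemma min_over_attained:
  fixes f :: "'a::topological_space \<Rightarrow> 'b::linorder_topology"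
  assumes "compact S" "S \<noteq> {}" "continuous_on S f"
  obtains x where "x \<in> S" "min_over S f = f x" "\<And>y. y \<in> S \<Longrightarrow> f x \<le> f y"
proof -
  obtain x where "x \<in> S" "\<And>y. y \<in> S \<Longrightarrow> f x \<le> f y"
    using continuous_attains_inf[OF assms] by blast
  then show ?thesis using min_over_eqI[of x S f] that by blast
qed

text \<open>A tube lemma for an arbitrary filter \<open>F\<close>: finitely many of the
  neighbourhoods on which \<open>P\<close> holds cover \<open>K\<close>, and finitely many eventual
  properties hold together. It turns local bounds into bounds uniform over \<Theta> or
  \<open>X\<close>.\<close>

lemma eventually_ball_compact:
  fixes K :: "'a::topological_space set"
  assumes "compact K"
    and P: "\<And>k. k \<in> K \<Longrightarrow> \<forall>\<^sub>F (x, y) in F \<times>\<^sub>F nhds k. y \<in> K \<longrightarrow> P x y"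
  shows "\<forall>\<^sub>F x in F. \<forall>y\<in>K. P x y"
proof -
  have "\<exists>Q U. eventually Q F \<and> open U \<and> k \<in> U \<and> (\<forall>x y. Q x \<longrightarrow> y \<in> U \<longrightarrow> y \<in> K \<longrightarrow> P x y)"
    if "k \<in> K" for k
    using P[OF that] unfolding eventually_prod_filter eventually_nhds by (auto; metis)
  then obtain Q U where QU: "\<And>k. k \<in> K \<Longrightarrow> eventually (Q k) F \<and> open (U k) \<and> k \<in> U k \<and>
      (\<forall>x y. Q k x \<longrightarrow> y \<in> U k \<longrightarrow> y \<in> K \<longrightarrow> P x y)"
    by metis
  obtain C where C: "C \<subseteq> K" "finite C" "K \<subseteq> (\<Union>k\<in>C. U k)"
    using compactE_image[OF \<open>compact K\<close>, of K U] QU by blast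
  have "\<forall>\<^sub>F x in F. \<forall>k\<in>C. Q k x"
    using C QU by (intro eventually_ball_finite) auto
  then show ?thesis
    by (rule eventually_mono) (use C QU in blast)
qed

text \<open>The premise at \<open>x\<close> accounts for the centre, which the punctured filter
  omits.\<close>

lemma eventually_at_within_iff_nhds:
  assumes "P x"
  shows "eventually P (at x within S) \<longleftrightarrow> (\<forall>\<^sub>F y in nhds x. y \<in> S \<longrightarrow> P y)"
  unfolding eventually_at_filter using assms by (intro arg_cong2[where f=eventually]) auto

text \<open>The form with \<open>nhds\<close> and a membership premise lets each half be pulled back
  along maps tending to \<open>x\<close> and combined with product filters.\<close>

lemma continuous_on_iff_semicontinuous:
  fixes f :: "'a::topological_space \<Rightarrow> 'b::linorder_topology"
  shows "continuous_on S f \<longleftrightarrow>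
    (\<forall>x\<in>S. (\<forall>c. f x < c \<longrightarrow> (\<forall>\<^sub>F y in nhds x. y \<in> S \<longrightarrow> f y < c)) \<and>
             (\<forall>c. c < f x \<longrightarrow> (\<forall>\<^sub>F y in nhds x. y \<in> S \<longrightarrow> c < f y)))"
  unfolding continuous_on_def order_tendsto_iff
  by (auto simp: eventually_at_within_iff_nhds)

lemma lsc_on_nhds:
  assumes "lsc_on S f" "x \<in> S" "c < f x"
  shows "\<forall>\<^sub>F y in nhds x. y \<in> S \<longrightarrow> c < f y"
  using assms by (simp add: lsc_on_def eventually_at_within_iff_nhds[symmetric])

text \<open>If the supremum \<open>s\<close> were not attained, every point would have a
  neighbourhood on which \<open>f\<close> stays below some real number smaller than
  \<open>s\<close>; by compactness one bound below \<open>s\<close> would then serve all of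
  \<open>S\<close>. Real thresholds suffice by density, and they are what the level set descriptions
  provide.\<close>

lemma usc_attains_max_over:
  fixes f :: "'a::topological_space \<Rightarrow> ereal"
  assumes "compact S" "S \<noteq> {}"
    and usc: "\<And>x c. x \<in> S \<Longrightarrow> f x < ereal c \<Longrightarrow> \<forall>\<^sub>F y in nhds x. y \<in> S \<longrightarrow> f y < ereal c"
  shows "attains_max_over S f"
proof (rule ccontr)
  define s where "s = (SUP x\<in>S. f x)"
  assume "\<not> attains_max_over S f"
  then have less: "f x < s" if "x \<in> S" for x
    using that unfolding attains_max_over_def s_def by (meson SUP_upper less_le_trans not_le)
  obtain x0 where "x0 \<in> S" using \<open>S \<noteq> {}\<close> by blast
  have "\<forall>\<^sub>F c in at_left s. \<forall>y\<in>S. f y \<le> c"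
  proof (rule eventually_ball_compact[OF \<open>compact S\<close>])
    fix k assume "k \<in> S"
    obtain b where b: "f k < ereal b" "ereal b < s"
      using ereal_dense2[OF less[OF \<open>k \<in> S\<close>]] by blast
    have "\<forall>\<^sub>F c in at_left s. ereal b < c"
      by (rule eventually_at_leftI[OF _ b(2)]) auto
    with usc[OF \<open>k \<in> S\<close> b(1)]
    show "\<forall>\<^sub>F (c, y) in at_left s \<times>\<^sub>F nhds k. y \<in> S \<longrightarrow> f y \<le> c"
      unfolding eventually_prod_filter by (fastforce dest: less_trans)
  qed
  moreover have "\<forall>\<^sub>F c in at_left s. c < s"
    by (simp add: eventually_at_filter)
  ultimately have "\<forall>\<^sub>F c in at_left s. False"
  proof eventually_elim
    case (elim c)
    then have "s \<le> c" unfolding s_def by (intro SUP_least) auto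
    with elim show ?case by simp
  qed
  \<comment> \<open>Since \<open>f x0\<close> lies strictly below \<open>s\<close>, the filter
    \<open>at_left s\<close> is nontrivial, also for infinite \<open>s\<close>.\<close>
  then show False
    unfolding eventually_at_left[OF less[OF \<open>x0 \<in> S\<close>]] using dense by blast
qed

text \<open>A minimiser at \<open>z\<close> keeps nearby minima small; the tube argument over
  \<open>X\<close> keeps them large. This makes the loss built from \<open>H\<close> admissible in
  the Laplace principle.\<close>

lemma continuous_on_min_over:
  fixes H :: "'x::topological_space \<Rightarrow> 'z::topological_space \<Rightarrow> 'b::linorder_topology"
  assumes "compact X" "X \<noteq> {}" and H: "continuous_on (X \<times> UNIV) (\<lambda>(x, z). H x z)"
  shows "continuous_on UNIV (\<lambda>z. min_over X (\<lambda>x. H x z))"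
proof -
  have "continuous_on X (\<lambda>x. H x z)" for z
  proof -
    have "continuous_on X (\<lambda>x. (x, z))" by (intro continuous_intros)
    from continuous_on_compose2[OF H this] show ?thesis by auto
  qed
  then have min: "\<exists>x\<in>X. min_over X (\<lambda>x. H x z) = H x z \<and> (\<forall>y\<in>X. H x z \<le> H y z)" for z
    using min_over_attained[OF assms(1,2)] by metis
  have pair: "((\<lambda>z. (x, z)) \<longlongrightarrow> (x, z)) (nhds z)" for x :: 'x and z :: 'z
    by (auto intro!: tendsto_eq_intros filterlim_ident)
  \<comment> \<open>\<open>H\<close> takes the decision first, whereas the tube argument expects the
    compact variable last.\<close>
  have swap: "((\<lambda>(z, x). (x, z)) \<longlongrightarrow> (x, z)) (nhds z \<times>\<^sub>F nhds x)" for x :: 'x and z :: 'z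
    unfolding nhds_prod[symmetric] split_beta
    by (auto intro!: tendsto_eq_intros filterlim_ident)
  show ?thesis
    unfolding continuous_on_iff_semicontinuous
  proof (intro ballI conjI allI impI)
    fix z c assume c: "min_over X (\<lambda>x. H x z) < c"
    obtain x where x: "x \<in> X" "H x z < c" using min[of z] c by auto
    then have "\<forall>\<^sub>F p in nhds (x, z). p \<in> X \<times> UNIV \<longrightarrow> (case p of (x, z) \<Rightarrow> H x z) < c"
      using H unfolding continuous_on_iff_semicontinuous by auto
    from filterlim_iff[THEN iffD1, OF pair, rule_format, OF this]
    have "\<forall>\<^sub>F z' in nhds z. H x z' < c" using x by simp
    then show "\<forall>\<^sub>F z' in nhds z. z' \<in> UNIV \<longrightarrow> min_over X (\<lambda>x. H x z') < c"
      by eventually_elim (metis min x(1) le_less_trans)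
  next
    fix z c assume c: "c < min_over X (\<lambda>x. H x z)"
    have "\<forall>\<^sub>F z' in nhds z. \<forall>x\<in>X. c < H x z'"
    proof (rule eventually_ball_compact[OF \<open>compact X\<close>])
      fix x assume x: "x \<in> X"
      then have "c < H x z" using c min[of z] by fastforce
      then have "\<forall>\<^sub>F p in nhds (x, z). p \<in> X \<times> UNIV \<longrightarrow> c < (case p of (x, z) \<Rightarrow> H x z)"
        using H x unfolding continuous_on_iff_semicontinuous by auto
      from filterlim_iff[THEN iffD1, OF swap, rule_format, OF this]
      show "\<forall>\<^sub>F (z', x') in nhds z \<times>\<^sub>F nhds x. x' \<in> X \<longrightarrow> c < H x' z'"
        by (rule eventually_mono) auto
    qed
    then show "\<forall>\<^sub>F z' in nhds z. z' \<in> UNIV \<longrightarrow> c < min_over X (\<lambda>x. H x z')"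
      by eventually_elim (metis min)
  qed
qed

section \<open>The inverse penalty and level sets\<close>

lemma penalty_inv_simps:
  assumes "penalty l"
  shows "penalty_inv l (ereal y) = ereal (inv l y)" "penalty_inv l \<infinity> = \<infinity>"
proof -
  have l: "bij l" using assms by (simp add: penalty_def)
  \<comment> \<open>\<open>inv\<close> only chooses some preimage; injectivity makes that choice the
    genuine inverse on the range.\<close>
  have "inj (penalty_ext l)"
  proof (rule injI)
    fix x y assume "penalty_ext l x = penalty_ext l y"
    then show "x = y" using bij_is_inj[OF l] by (cases x; cases y) (auto dest: injD)
  qed
  then show "penalty_inv l (ereal y) = ereal (inv l y)" "penalty_inv l \<infinity> = \<infinity>"
    unfolding penalty_inv_def
    by (auto intro!: inv_f_eq simp: surj_f_inv_f[OF bij_is_surj[OF l]])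
qed

text \<open>Strict level sets of the penalized function are expressed through \<open>I\<close> and \<open>l\<close> alone, so that
  neither the inverse penalty nor infinite values appear in the continuity arguments.\<close>

lemma penalized_less_iff:
  assumes l: "penalty l" and "0 \<le> I \<theta> z"
  shows "penalized g l I r x z \<theta> < ereal c \<longleftrightarrow> ereal (l (g x \<theta> - c) + r) < I \<theta> z"
    and "ereal c < penalized g l I r x z \<theta> \<longleftrightarrow> I \<theta> z < ereal (l (g x \<theta> - c) + r)"
proof -
  have "strict_mono l" "bij l" using l by (auto simp: penalty_def)
  have *: "l a < b \<longleftrightarrow> a < inv l b" "b < l a \<longleftrightarrow> inv l b < a" for a b
    using strict_mono_less[OF \<open>strict_mono l\<close>] surj_f_inv_f[OF bij_is_surj[OF \<open>bij l\<close>]] by metis+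
  have **: "l (g x \<theta> - c) + r < i \<longleftrightarrow> l (g x \<theta> - c) < i - r"
      "i < l (g x \<theta> - c) + r \<longleftrightarrow> i - r < l (g x \<theta> - c)" for i by auto
  show "penalized g l I r x z \<theta> < ereal c \<longleftrightarrow> ereal (l (g x \<theta> - c) + r) < I \<theta> z"
    "ereal c < penalized g l I r x z \<theta> \<longleftrightarrow> I \<theta> z < ereal (l (g x \<theta> - c) + r)"
    using assms(2) unfolding penalized_def
    by (cases "I \<theta> z"; auto simp: penalty_inv_simps[OF l] ** *)+
qed

section \<open>Minimax for strictly convex decisions and concave parameters\<close>

text \<open>Let \<open>\<theta>s\<close> maximise \<open>m \<theta> = min\<^sub>x f x \<theta>\<close> and let \<open>xs\<close> be the minimiser at \<open>\<theta>s\<close>, unique by strict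
  convexity. Moving from \<open>\<theta>s\<close> towards \<open>\<theta>\<close> by a small \<open>t\<close>, concavity and maximality of \<open>\<theta>s\<close> force every
  minimiser at the new parameter into the level set \<open>f x \<theta> \<le> m \<theta>s\<close>. If \<open>xs\<close> lay outside this level
  set, then \<open>f x \<theta>s\<close> would exceed \<open>m \<theta>s\<close> uniformly on it, a contradiction as \<open>t\<close> tends to \<open>0\<close>.\<close>

lemma convex_concave_minimax:
  fixes X :: "'x::{topological_space,real_vector} set"
    and \<Theta> :: "'t::{topological_space,real_vector} set"
    and g :: "'x \<Rightarrow> 't \<Rightarrow> real" and h :: "'t \<Rightarrow> ereal"
  defines "f \<equiv> \<lambda>x \<theta>. ereal (g x \<theta>) - h \<theta>"
  assumes X: "compact X" "X \<noteq> {}" and \<Theta>: "compact \<Theta>"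
    and cont: "\<And>\<theta>. \<theta> \<in> \<Theta> \<Longrightarrow> continuous_on X (\<lambda>x. g x \<theta>)"
    and convex: "\<And>\<theta>. \<theta> \<in> \<Theta> \<Longrightarrow> strictly_convex_on X (\<lambda>x. g x \<theta>)"
    and concave: "\<And>x. x \<in> X \<Longrightarrow> ereal_concave_on \<Theta> (f x)"
    and finite: "\<exists>\<theta>\<in>\<Theta>. h \<theta> < \<infinity>"
    and usc: "\<And>x \<theta> c. x \<in> X \<Longrightarrow> \<theta> \<in> \<Theta> \<Longrightarrow> f x \<theta> < ereal c \<Longrightarrow>
      \<forall>\<^sub>F \<theta>' in nhds \<theta>. \<theta>' \<in> \<Theta> \<longrightarrow> f x \<theta>' < ereal c"
    and le: "\<And>\<theta>. \<theta> \<in> \<Theta> \<Longrightarrow> \<exists>x\<in>X. f x \<theta> \<le> ereal c"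
  shows "\<exists>x\<in>X. \<forall>\<theta>\<in>\<Theta>. f x \<theta> \<le> ereal c"
proof -
  define m where "m \<theta> = (INF x\<in>X. f x \<theta>)" for \<theta>
  obtain x0 where "x0 \<in> X" using X by blast
  have h: "h \<theta> \<noteq> -\<infinity>" if "\<theta> \<in> \<Theta>" for \<theta>
    using concave[OF \<open>x0 \<in> X\<close>] that unfolding ereal_concave_on_def f_def by force
  have convex_\<Theta>: "convex \<Theta>"
    using concave[OF \<open>x0 \<in> X\<close>] unfolding ereal_concave_on_def by blast
  \<comment> \<open>\<open>h \<theta>\<close> does not depend on \<open>x\<close>, so a minimiser of
    the real function \<open>g\<close> attains the extended infimum as well.\<close>
  have min: "\<exists>x\<in>X. m \<theta> = f x \<theta> \<and> (\<forall>y\<in>X. g x \<theta> \<le> g y \<theta>)" if \<theta>: "\<theta> \<in> \<Theta>" for \<theta>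
  proof -
    obtain x where x: "x \<in> X" "\<forall>y\<in>X. g x \<theta> \<le> g y \<theta>"
      using continuous_attains_inf[OF X cont[OF \<theta>]] by blast
    have "m \<theta> = f x \<theta>" unfolding m_def f_def
      using x by (intro antisym INF_lower INF_greatest ereal_minus_mono) auto
    then show ?thesis using x by blast
  qed
  have "attains_max_over \<Theta> m"
  proof (rule usc_attains_max_over[OF \<Theta>])
    fix \<theta> c assume "\<theta> \<in> \<Theta>" "m \<theta> < ereal c"
    then obtain x where x: "x \<in> X" "f x \<theta> < ereal c" using min by metis
    from usc[OF x(1) \<open>\<theta> \<in> \<Theta>\<close> x(2)]
    show "\<forall>\<^sub>F y in nhds \<theta>. y \<in> \<Theta> \<longrightarrow> m y < ereal c"
      by eventually_elim (auto simp: m_def INF_less_iff x(1) intro!: bexI[of _ x])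
  qed (use finite in blast)
  then obtain \<theta>s where \<theta>s: "\<theta>s \<in> \<Theta>" "\<And>\<theta>. \<theta> \<in> \<Theta> \<Longrightarrow> m \<theta> \<le> m \<theta>s"
    unfolding attains_max_over_def by blast
  obtain xs where xs: "xs \<in> X" "m \<theta>s = f xs \<theta>s" "\<And>y. y \<in> X \<Longrightarrow> g xs \<theta>s \<le> g y \<theta>s"
    using min[OF \<theta>s(1)] by blast
  \<comment> \<open>One parameter with finite \<open>h\<close> makes the maximal value of
    \<open>m\<close> finite, hence also \<open>h \<theta>s\<close>; the comparison can then be made
    in the reals.\<close>
  obtain \<theta>0 where \<theta>0: "\<theta>0 \<in> \<Theta>" "h \<theta>0 < \<infinity>" using finite by blast
  obtain x1 where "m \<theta>0 = f x1 \<theta>0" using min[OF \<theta>0(1)] by blast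
  then have "m \<theta>0 \<noteq> -\<infinity>" using \<theta>0 h[OF \<theta>0(1)] by (cases "h \<theta>0") (auto simp: f_def)
  then have "m \<theta>s \<noteq> -\<infinity>" using \<theta>s(2)[OF \<theta>0(1)] by auto
  then obtain a where a: "h \<theta>s = ereal a"
    using h[OF \<theta>s(1)] xs(2) by (cases "h \<theta>s") (auto simp: f_def)
  define \<mu> where "\<mu> = g xs \<theta>s - a"
  have \<mu>: "m \<theta>s = ereal \<mu>" by (simp add: xs(2) f_def a \<mu>_def)
  have "f xs \<theta> \<le> ereal \<mu>" if \<theta>: "\<theta> \<in> \<Theta>" for \<theta>
  \<comment> \<open>For infinite \<open>h \<theta>\<close> the value \<open>f xs \<theta>\<close> is
    minus infinity and the bound is immediate.\<close>
  proof (cases "h \<theta>")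
    case (real b)
    define u where "u x = g x \<theta> - b" for x
    define v where "v x = g x \<theta>s - a" for x
    have cont_uv: "continuous_on X u" "continuous_on X v"
      unfolding u_def v_def using cont \<theta> \<theta>s(1) by (auto intro!: continuous_intros)
    have v_ge: "\<mu> \<le> v x" if "x \<in> X" for x using xs(3)[OF that] by (simp add: \<mu>_def v_def)
    have step: "\<exists>x\<in>X. (1 - t) * v x + t * u x \<le> \<mu>" if t: "0 < t" "t < 1" for t
    proof -
      define \<tau> where "\<tau> = (1 - t) *\<^sub>R \<theta>s + t *\<^sub>R \<theta>"
      have \<tau>: "\<tau> \<in> \<Theta>"
        unfolding \<tau>_def using t \<theta> \<theta>s(1) by (intro convexD[OF convex_\<Theta>]) auto
      obtain x where x: "x \<in> X" "m \<tau> = f x \<tau>" using min[OF \<tau>] by blast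
      have "ereal (1 - t) * f x \<theta>s + ereal t * f x \<theta> \<le> f x \<tau>"
        using concave[OF x(1)] \<theta> \<theta>s(1) t unfolding ereal_concave_on_def \<tau>_def by auto
      also have "\<dots> \<le> ereal \<mu>" using \<theta>s(2)[OF \<tau>] x(2) \<mu> by simp
      finally show ?thesis
        using x(1) by (intro bexI[of _ x]) (simp_all add: f_def a real u_def v_def)
    qed
    have "u xs \<le> \<mu>"
    proof (rule ccontr)
      assume neg: "\<not> u xs \<le> \<mu>"
      define K where "K = {x \<in> X. u x \<le> \<mu>}"
      have step': "\<exists>x\<in>K. (1 - t) * v x + t * u x \<le> \<mu>" if t: "0 < t" "t < 1" for t
      proof -
        obtain x where x: "x \<in> X" "(1 - t) * v x + t * u x \<le> \<mu>" using step[OF t] by blast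
        \<comment> \<open>As \<open>v x\<close> is at least \<open>\<mu>\<close>, the mixture can be
          at most \<open>\<mu>\<close> only if \<open>u x\<close> is, which puts \<open>x\<close>
          into \<open>K\<close>.\<close>
        have "(1 - t) * \<mu> \<le> (1 - t) * v x" using v_ge[OF x(1)] t by (intro mult_left_mono) auto
        with x(2) have "t * u x \<le> t * \<mu>" by (simp add: algebra_simps)
        then have "x \<in> K" using x t by (simp add: K_def)
        with x show ?thesis by blast
      qed
      have "closedin (top_of_set X) K"
        using continuous_closedin_preimage[OF cont_uv(1), of "{..\<mu>}"]
        by (simp add: K_def vimage_def Int_def)
      then have K: "compact K" using X(1) closedin_compact by blast
      have "K \<noteq> {}" using step'[of "1/2"] by auto
      have KX: "K \<subseteq> X" by (auto simp: K_def)
      \<comment> \<open>The point supplied by \<open>step'\<close> varies with \<open>t\<close>.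
        Minimising \<open>v\<close> and \<open>u\<close> separately over \<open>K\<close> replaces
        it by fixed constants, so the limit in \<open>t\<close> involves no choice of
        subsequence.\<close>
      obtain y where y: "y \<in> K" "\<And>x. x \<in> K \<Longrightarrow> v y \<le> v x"
        using continuous_attains_inf[OF K \<open>K \<noteq> {}\<close> continuous_on_subset[OF cont_uv(2) KX]] by blast
      obtain w where w: "w \<in> K" "\<And>x. x \<in> K \<Longrightarrow> u w \<le> u x"
        using continuous_attains_inf[OF K \<open>K \<noteq> {}\<close> continuous_on_subset[OF cont_uv(1) KX]] by blast
      have "xs \<noteq> y" "y \<in> X" using neg y(1) by (auto simp: K_def)
      \<comment> \<open>Otherwise \<open>y\<close> would be a second minimiser of \<open>v\<close>,
        and strict convexity would push the midpoint below the minimum.\<close>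
      have "\<mu> < v y"
      proof -
        define p where "p = (1/2) *\<^sub>R xs + (1/2) *\<^sub>R y"
        have sc: "strictly_convex_on X (\<lambda>x. g x \<theta>s)" using convex \<theta>s(1) by blast
        then have "convex X" by (simp add: strictly_convex_on_def)
        then have "p \<in> X"
          unfolding p_def using xs(1) \<open>y \<in> X\<close> by (intro convexD) auto
        then have "g xs \<theta>s \<le> g p \<theta>s" by (rule xs(3))
        also have "g p \<theta>s < 1/2 * g xs \<theta>s + 1/2 * g y \<theta>s"
          using sc[unfolded strictly_convex_on_def, THEN conjunct2, rule_format,
              OF xs(1) \<open>y \<in> X\<close> \<open>xs \<noteq> y\<close>, of "1/2" "1/2"] by (simp add: p_def)
        finally show ?thesis by (simp add: \<mu>_def v_def)
      qed
      have "\<forall>\<^sub>F t in at_right (0::real). 0 < t \<and> t < 1"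
        by (auto simp: eventually_at_right_field intro!: exI[of _ 1])
      then have "\<forall>\<^sub>F t in at_right (0::real). (1 - t) * v y + t * u w \<le> \<mu>"
      proof eventually_elim
        case (elim t)
        then obtain x where x: "x \<in> K" "(1 - t) * v x + t * u x \<le> \<mu>" using step' by blast
        have "(1 - t) * v y \<le> (1 - t) * v x" "t * u w \<le> t * u x"
          using elim y(2)[OF x(1)] w(2)[OF x(1)] by (simp_all add: mult_left_mono)
        with x(2) show ?case by linarith
      qed
      moreover have "((\<lambda>t. (1 - t) * v y + t * u w) \<longlongrightarrow> (1 - 0) * v y + 0 * u w) (at_right (0::real))"
        by (intro tendsto_intros)
      ultimately have "v y \<le> \<mu>"
        using tendsto_upperbound[of _ "v y" "at_right (0::real)" \<mu>] by simp
      with \<open>\<mu> < v y\<close> show False by simp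
    qed
    then show ?thesis by (simp add: f_def real u_def)
  qed (use h[OF \<theta>] in \<open>auto simp: f_def\<close>)
  moreover have "ereal \<mu> \<le> ereal c"
  proof -
    obtain x where "x \<in> X" "f x \<theta>s \<le> ereal c" using le[OF \<theta>s(1)] by blast
    then show ?thesis unfolding \<mu>[symmetric] m_def by (rule INF_lower2)
  qed
  ultimately show ?thesis using xs(1) order_trans by blast
qed

text \<open>By first countability, a property of points near \<open>z\<close> need only be checked
  along sequences tending to \<open>z\<close>, and there the recovery sequence supplies the
  parameter. This is the form of condition (III) used for lower semicontinuity of
  \<open>G\<close>.\<close>

lemma recovery_eventually:
  fixes I :: "'t::topological_space \<Rightarrow> 'z::first_countable_topology \<Rightarrow> ereal"
  assumes recovery: "\<And>zs. zs \<longlonglongrightarrow> z \<Longrightarrow>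
      \<exists>\<theta>s. (\<forall>n. \<theta>s n \<in> \<Theta>) \<and> \<theta>s \<longlonglongrightarrow> \<theta> \<and> (\<lambda>n. I (\<theta>s n) (zs n)) \<longlonglongrightarrow> I \<theta> z"
    and U: "\<forall>\<^sub>F \<theta>' in nhds \<theta>. \<theta>' \<in> \<Theta> \<longrightarrow> Q \<theta>'" and b: "I \<theta> z < b"
  shows "\<forall>\<^sub>F z' in nhds z. \<exists>\<theta>'\<in>\<Theta>. Q \<theta>' \<and> I \<theta>' z' < b"
proof -
  have "\<forall>\<^sub>F n in sequentially. \<exists>\<theta>'\<in>\<Theta>. Q \<theta>' \<and> I \<theta>' (zs n) < b" if zs: "zs \<longlonglongrightarrow> z" for zs
  proof -
    obtain \<theta>s where \<theta>s: "\<And>n. \<theta>s n \<in> \<Theta>" "\<theta>s \<longlonglongrightarrow> \<theta>" "(\<lambda>n. I (\<theta>s n) (zs n)) \<longlonglongrightarrow> I \<theta> z"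
      using recovery[OF zs] by blast
    have "\<forall>\<^sub>F n in sequentially. I (\<theta>s n) (zs n) < b"
      using order_tendstoD(2)[OF \<theta>s(3) b] .
    moreover have "\<forall>\<^sub>F n in sequentially. Q (\<theta>s n)"
      using filterlim_iff[THEN iffD1, OF \<theta>s(2), rule_format, OF U] \<theta>s(1) by simp
    ultimately show ?thesis
      by eventually_elim (use \<theta>s(1) in blast)
  qed
  then show ?thesis
    using sequentially_imp_eventually_nhds_within[of UNIV z] by simp
qed

theorem proposition3p6:
  fixes X :: "'x::real_topological_vector set"
    and \<Theta> :: "'t::real_topological_vector set"
    and M :: "'w measure"
    and P :: "'t \<Rightarrow> 'w measure"
    and Z :: "nat \<Rightarrow> 'w \<Rightarrow> 'z::metric_space"
    and g :: "'x \<Rightarrow> 't \<Rightarrow> real"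
    and l :: "real \<Rightarrow> real"
    and r :: real
    and \<phi> :: "'t \<Rightarrow> (nat \<Rightarrow> 'w \<Rightarrow> real) \<Rightarrow> ereal"
    and I :: "'t \<Rightarrow> 'z \<Rightarrow> ereal"
    and G :: "'x \<Rightarrow> 'z \<Rightarrow> real"
  assumes X: "metrizable_compact_convex X"
    and \<Theta>: "metrizable_compact_convex \<Theta>"
    and P: "\<And>\<theta>. \<theta> \<in> \<Theta> \<Longrightarrow> prob_space (P \<theta>) \<and> sets (P \<theta>) = sets M"
    and Z: "\<And>n. Z n \<in> borel_measurable M"
    and g_cont: "continuous_on (X \<times> \<Theta>) (\<lambda>(x, \<theta>). g x \<theta>)"
    and g_convex: "\<And>\<theta>. \<theta> \<in> \<Theta> \<Longrightarrow> strictly_convex_on X (\<lambda>x. g x \<theta>)"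
    and l: "penalty l"
    and r: "r > 0"
    and Laplace: "\<And>f \<theta>. continuous_on UNIV f \<Longrightarrow> \<theta> \<in> \<Theta> \<Longrightarrow>
          \<phi> \<theta> (\<lambda>n \<omega>. f (Z n \<omega>)) = (SUP z. ereal (f z) - I \<theta> z)"
    and I_nonneg: "\<And>\<theta> z. \<theta> \<in> \<Theta> \<Longrightarrow> 0 \<le> I \<theta> z"
    and I_finite: "\<And>z. \<exists>\<theta>\<in>\<Theta>. I \<theta> z < \<infinity>"
    and I_lsc: "lsc_on (\<Theta> \<times> UNIV) (\<lambda>(\<theta>, z). I \<theta> z)"
    and I_recovery: "\<And>\<theta> z zs. \<theta> \<in> \<Theta> \<Longrightarrow> I \<theta> z < \<infinity> \<Longrightarrow> zs \<longlonglongrightarrow> z \<Longrightarrow>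
          \<exists>\<theta>s. (\<forall>n. \<theta>s n \<in> \<Theta>) \<and> \<theta>s \<longlonglongrightarrow> \<theta> \<and> (\<lambda>n. I (\<theta>s n) (zs n)) \<longlonglongrightarrow> I \<theta> z"
    and concave: "\<And>x z. x \<in> X \<Longrightarrow> ereal_concave_on \<Theta> (penalized g l I r x z)"
    and G_def: "\<And>x z. G x z = real_of_ereal (max_over \<Theta> (penalized g l I r x z))"
  shows "(\<forall>x\<in>X. \<forall>z. attains_max_over \<Theta> (penalized g l I r x z) \<and>
              ereal (G x z) = max_over \<Theta> (penalized g l I r x z)) \<and>
         feasible X \<Theta> g l r Z \<phi> G \<and>
         (\<forall>H. feasible X \<Theta> g l r Z \<phi> H \<longrightarrow>
            (\<forall>z. min_over X (\<lambda>x. G x z) \<le> min_over X (\<lambda>x. H x z)))"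
proof -

  \<comment> \<open>Real level sets of the penalized function\<close>
  let ?p = "penalized g l I r"
  have X': "compact X" "X \<noteq> {}" and \<Theta>': "compact \<Theta>" "\<Theta> \<noteq> {}"
    using X \<Theta> by (auto simp: metrizable_compact_convex_def)
  have l_cont: "continuous_on UNIV l"
    using l by (simp add: penalty_def)
  have less_iff: "?p x z \<theta> < ereal c \<longleftrightarrow> ereal (l (g x \<theta> - c) + r) < I \<theta> z"
    "ereal c < ?p x z \<theta> \<longleftrightarrow> I \<theta> z < ereal (l (g x \<theta> - c) + r)" if "\<theta> \<in> \<Theta>" for x z \<theta> c
    by (rule penalized_less_iff[OF l, where I=I, OF I_nonneg[OF that]])+
  have le_iff: "?p x z \<theta> \<le> ereal c \<longleftrightarrow> ereal (l (g x \<theta> - c) + r) \<le> I \<theta> z"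
    if "\<theta> \<in> \<Theta>" for x z \<theta> c
    by (metis less_iff(2)[OF that] not_less)
  have g_cont1: "continuous_on X (\<lambda>x. g x \<theta>)" if "\<theta> \<in> \<Theta>" for \<theta>
  proof -
    have "continuous_on X (\<lambda>x. (x, \<theta>))" by (intro continuous_intros)
    from continuous_on_compose2[OF g_cont this] show ?thesis using that by auto
  qed
  have level_cont: "continuous_on (X \<times> \<Theta>) (\<lambda>(x, \<theta>). l (g x \<theta> - c) + r)" for c
  proof -
    have "continuous_on (X \<times> \<Theta>) (\<lambda>q. (case q of (x, \<theta>) \<Rightarrow> g x \<theta>) - c)"
      by (intro continuous_on_diff g_cont continuous_on_const)
    from continuous_on_compose2[OF l_cont this] show ?thesis
      unfolding split_beta by (intro continuous_on_add continuous_on_const) auto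
  qed

  \<comment> \<open>Joint upper semicontinuity and attainment of the maximum\<close>
  have usc: "\<forall>\<^sub>F ((x', z'), \<theta>') in nhds (x, z) \<times>\<^sub>F nhds \<theta>. x' \<in> X \<longrightarrow> \<theta>' \<in> \<Theta> \<longrightarrow> ?p x' z' \<theta>' < ereal c"
    if x: "x \<in> X" and \<theta>: "\<theta> \<in> \<Theta>" and c: "?p x z \<theta> < ereal c" for x z \<theta> c
  proof -
    \<comment> \<open>The intermediate \<open>b\<close> separates the two variations: continuity of
      \<open>g\<close> and \<open>l\<close> controls the side below it, lower semicontinuity of
      \<open>I\<close> the side above.\<close>
    obtain b where b: "l (g x \<theta> - c) + r < b" "ereal b < I \<theta> z"
      using c ereal_dense2 unfolding less_iff(1)[OF \<theta>] by force
    have 1: "\<forall>\<^sub>F q in nhds (x, \<theta>). q \<in> X \<times> \<Theta> \<longrightarrow> (case q of (x, \<theta>) \<Rightarrow> l (g x \<theta> - c) + r) < b"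
      using level_cont[of c] x \<theta> b(1) unfolding continuous_on_iff_semicontinuous by auto
    have 2: "\<forall>\<^sub>F q in nhds (\<theta>, z). q \<in> \<Theta> \<times> UNIV \<longrightarrow> ereal b < (case q of (\<theta>, z) \<Rightarrow> I \<theta> z)"
      using lsc_on_nhds[OF I_lsc, of "(\<theta>, z)" "ereal b"] \<theta> b(2) by auto
    have l1: "((\<lambda>q. (fst (fst q), snd q)) \<longlongrightarrow> (x, \<theta>)) (nhds ((x, z), \<theta>))"
      and l2: "((\<lambda>q. (snd q, snd (fst q))) \<longlongrightarrow> (\<theta>, z)) (nhds ((x, z), \<theta>))"
      by (auto intro!: tendsto_eq_intros filterlim_ident)
    from filterlim_iff[THEN iffD1, OF l1, rule_format, OF 1]
      filterlim_iff[THEN iffD1, OF l2, rule_format, OF 2]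
    show ?thesis
      unfolding nhds_prod[of "(x, z)" \<theta>, symmetric]
      by eventually_elim (auto simp: less_iff intro: less_trans[of _ "ereal b"])
  qed
  have usc_\<theta>: "\<forall>\<^sub>F \<theta>' in nhds \<theta>. \<theta>' \<in> \<Theta> \<longrightarrow> ?p x z \<theta>' < ereal c"
    if x: "x \<in> X" and \<theta>: "\<theta> \<in> \<Theta>" and c: "?p x z \<theta> < ereal c" for x z \<theta> c
  proof -
    have "((\<lambda>\<theta>. ((x, z), \<theta>)) \<longlongrightarrow> ((x, z), \<theta>)) (nhds \<theta>)"
      by (auto intro!: tendsto_eq_intros filterlim_ident)
    from filterlim_iff[THEN iffD1, OF this[unfolded nhds_prod[of "(x, z)"]], rule_format, OF usc[OF that]]
    show ?thesis using x by simp
  qed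
  have attains: "attains_max_over \<Theta> (?p x z)" if "x \<in> X" for x z
    using usc_\<theta>[OF that] by (intro usc_attains_max_over[OF \<Theta>'])
  have G: "ereal (G x z) = max_over \<Theta> (?p x z) \<and> (\<exists>\<theta>\<in>\<Theta>. ?p x z \<theta> = ereal (G x z)) \<and>
      (\<forall>\<theta>\<in>\<Theta>. ?p x z \<theta> \<le> ereal (G x z))" if x: "x \<in> X" for x z
  proof -
    obtain \<theta> where \<theta>: "\<theta> \<in> \<Theta>" "\<And>\<theta>'. \<theta>' \<in> \<Theta> \<Longrightarrow> ?p x z \<theta>' \<le> ?p x z \<theta>"
      using attains[OF x] unfolding attains_max_over_def by blast
    have max: "max_over \<Theta> (?p x z) = ?p x z \<theta>" using \<theta> by (rule max_over_eqI)
    obtain \<theta>0 where \<theta>0: "\<theta>0 \<in> \<Theta>" "I \<theta>0 z < \<infinity>" using I_finite by blast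
    \<comment> \<open>Condition (I) excludes minus infinity and the concavity assumption excludes
      plus infinity, so \<open>real_of_ereal\<close> loses nothing in \<open>G\<close>.\<close>
    have "?p x z \<theta>0 \<noteq> -\<infinity>"
      using I_nonneg[OF \<theta>0(1), of z] \<theta>0(2)
      by (cases "I \<theta>0 z") (auto simp: penalized_def penalty_inv_simps[OF l])
    then have "?p x z \<theta> \<noteq> -\<infinity>" using \<theta>(2)[OF \<theta>0(1)] by auto
    moreover have "?p x z \<theta> \<noteq> \<infinity>"
      using concave[OF x, of z] \<theta>(1) unfolding ereal_concave_on_def by auto
    ultimately have "ereal (G x z) = ?p x z \<theta>"
      unfolding G_def max by (cases "?p x z \<theta>") auto
    with max \<theta> show ?thesis by metis
  qed

  \<comment> \<open>Continuity of \<open>G\<close>\<close>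
  have G_usc: "\<forall>\<^sub>F q in nhds (x, z). q \<in> X \<times> UNIV \<longrightarrow> (case q of (x, z) \<Rightarrow> G x z) < c"
    if x: "x \<in> X" and c: "G x z < c" for x z c
  proof -
    \<comment> \<open>Compactness of \<Theta> gives one neighbourhood of \<open>(x, z)\<close> for
      all parameters, including the maximisers at nearby points.\<close>
    have "\<forall>\<^sub>F q in nhds (x, z). \<forall>\<theta>\<in>\<Theta>. fst q \<in> X \<longrightarrow> ?p (fst q) (snd q) \<theta> < ereal c"
    proof (rule eventually_ball_compact[OF \<Theta>'(1)])
      fix \<theta> assume \<theta>: "\<theta> \<in> \<Theta>"
      have "?p x z \<theta> < ereal c" using G[OF x, of z] \<theta> c by (metis le_less_trans less_ereal.simps(1))
      from usc[OF x \<theta> this]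
      show "\<forall>\<^sub>F (q, \<theta>') in nhds (x, z) \<times>\<^sub>F nhds \<theta>. \<theta>' \<in> \<Theta> \<longrightarrow> fst q \<in> X \<longrightarrow>
          ?p (fst q) (snd q) \<theta>' < ereal c"
        by (rule eventually_mono) auto
    qed
    then show ?thesis
    proof eventually_elim
      case (elim q)
      show ?case
      proof
        assume "q \<in> X \<times> UNIV"
        then obtain x' z' where q: "q = (x', z')" "x' \<in> X" by auto
        then obtain \<theta> where "\<theta> \<in> \<Theta>" "?p x' z' \<theta> = ereal (G x' z')" using G by blast
        then show "(case q of (x, z) \<Rightarrow> G x z) < c" using elim q by fastforce
      qed
    qed
  qed
  have G_lsc: "\<forall>\<^sub>F q in nhds (x, z). q \<in> X \<times> UNIV \<longrightarrow> c < (case q of (x, z) \<Rightarrow> G x z)"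
    if x: "x \<in> X" and c: "c < G x z" for x z c
  proof -
    obtain \<theta> where \<theta>: "\<theta> \<in> \<Theta>" "?p x z \<theta> = ereal (G x z)" using G[OF x] by blast
    then have "I \<theta> z < ereal (l (g x \<theta> - c) + r)" using c unfolding less_iff(2)[OF \<theta>(1), symmetric] by simp
    then obtain b where b: "I \<theta> z < ereal b" "b < l (g x \<theta> - c) + r"
      using ereal_dense2 by force
    have "\<forall>\<^sub>F q in nhds (x, \<theta>). q \<in> X \<times> \<Theta> \<longrightarrow> b < (case q of (x, \<theta>) \<Rightarrow> l (g x \<theta> - c) + r)"
      using level_cont[of c] x \<theta>(1) b(2) unfolding continuous_on_iff_semicontinuous by auto
    \<comment> \<open>With a product neighbourhood, the recovered parameter can be chosen from
      \<open>z'\<close> alone and serves every \<open>x'\<close> near \<open>x\<close>.\<close>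
    then obtain Q R where Q: "eventually Q (nhds x)" and R: "eventually R (nhds \<theta>)"
      and QR: "\<And>x \<theta>. Q x \<Longrightarrow> R \<theta> \<Longrightarrow> x \<in> X \<Longrightarrow> \<theta> \<in> \<Theta> \<Longrightarrow> b < l (g x \<theta> - c) + r"
      unfolding nhds_prod eventually_prod_filter by auto
    have R': "\<forall>\<^sub>F \<theta>' in nhds \<theta>. \<theta>' \<in> \<Theta> \<longrightarrow> R \<theta>'"
      using R by eventually_elim simp
    have fin: "I \<theta> z < \<infinity>" using b(1) by auto
    have "\<forall>\<^sub>F z' in nhds z. \<exists>\<theta>'\<in>\<Theta>. R \<theta>' \<and> I \<theta>' z' < ereal b"
      by (rule recovery_eventually[where I=I, OF I_recovery[OF \<theta>(1) fin] R' b(1)])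
    from eventually_prodI[OF Q this]
    show ?thesis
      unfolding nhds_prod
    proof eventually_elim
      case (elim q)
      show ?case
      proof (cases q)
        case (Pair x' z')
        then obtain \<theta>' where \<theta>': "\<theta>' \<in> \<Theta>" "R \<theta>'" "I \<theta>' z' < ereal b" using elim by auto
        have "ereal c < ereal (G x' z')" if x': "x' \<in> X"
        proof -
          have "ereal b < ereal (l (g x' \<theta>' - c) + r)" using QR \<theta>' x' elim Pair by auto
          then have "ereal c < ?p x' z' \<theta>'"
            unfolding less_iff(2)[OF \<theta>'(1)] using \<theta>'(3) by (rule less_trans[rotated])
          also have "\<dots> \<le> ereal (G x' z')" using G[OF x'] \<theta>'(1) by blast
          finally show ?thesis .
        qed
        then show ?thesis using Pair by simp
      qed
    qed
  qed
  have G_cont: "continuous_on (X \<times> UNIV) (\<lambda>(x, z). G x z)"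
    unfolding continuous_on_iff_semicontinuous
  proof (intro ballI conjI allI impI)
    fix q c assume "q \<in> X \<times> (UNIV :: 'z set)" "(case q of (x, z) \<Rightarrow> G x z) < c"
    then show "\<forall>\<^sub>F q in nhds q. q \<in> X \<times> UNIV \<longrightarrow> (case q of (x, z) \<Rightarrow> G x z) < c"
      using G_usc by (cases q) simp
  next
    fix q c assume "q \<in> X \<times> (UNIV :: 'z set)" "c < (case q of (x, z) \<Rightarrow> G x z)"
    then show "\<forall>\<^sub>F q in nhds q. q \<in> X \<times> UNIV \<longrightarrow> c < (case q of (x, z) \<Rightarrow> G x z)"
      using G_lsc by (cases q) simp
  qed

  \<comment> \<open>The risk constraint as a pointwise inequality\<close>
  define m where "m \<theta> = min_over X (\<lambda>x. g x \<theta>)" for \<theta>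
  have risk_le_iff: "\<phi> \<theta> (\<lambda>n \<omega>. l (m \<theta> - min_over X (\<lambda>x. H x (Z n \<omega>)))) \<le> - ereal r \<longleftrightarrow>
      (\<forall>z. \<exists>x\<in>X. ?p x z \<theta> \<le> ereal (min_over X (\<lambda>x. H x z)))"
    if \<theta>: "\<theta> \<in> \<Theta>" and H: "continuous_on (X \<times> UNIV) (\<lambda>(x, z). H x z)" for \<theta> and H :: "'x \<Rightarrow> 'z \<Rightarrow> real"
  proof -
    define k where "k z = min_over X (\<lambda>x. H x z)" for z
    have k: "continuous_on UNIV k"
      unfolding k_def by (rule continuous_on_min_over[OF X' H])
    obtain x where x: "x \<in> X" "m \<theta> = g x \<theta>" "\<And>y. y \<in> X \<Longrightarrow> g x \<theta> \<le> g y \<theta>"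
      using min_over_attained[OF X' g_cont1[OF \<theta>]] unfolding m_def by metis
    have "continuous_on UNIV (\<lambda>z. l (m \<theta> - k z))"
      by (rule continuous_on_compose2[OF l_cont continuous_on_diff[OF continuous_on_const k]]) auto
    from Laplace[OF this \<theta>]
    have "\<phi> \<theta> (\<lambda>n \<omega>. l (m \<theta> - k (Z n \<omega>))) = (SUP z. ereal (l (m \<theta> - k z)) - I \<theta> z)" .
    moreover have "ereal (l (m \<theta> - k z)) - I \<theta> z \<le> - ereal r \<longleftrightarrow> (\<exists>x\<in>X. ?p x z \<theta> \<le> ereal (k z))" for z
    proof -
      \<comment> \<open>The penalty term is constant in \<open>x\<close>, so the minimiser
        \<open>x\<close> of \<open>g\<close> at \<theta> is the best witness for every
        \<open>z\<close>.\<close>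
      have "(\<exists>x\<in>X. ?p x z \<theta> \<le> ereal (k z)) \<longleftrightarrow> ?p x z \<theta> \<le> ereal (k z)"
      proof
        assume "\<exists>x\<in>X. ?p x z \<theta> \<le> ereal (k z)"
        then obtain y where y: "y \<in> X" "?p y z \<theta> \<le> ereal (k z)" by blast
        have "?p x z \<theta> \<le> ?p y z \<theta>"
          unfolding penalized_def using x(3)[OF y(1)] by (intro ereal_minus_mono) auto
        with y(2) show "?p x z \<theta> \<le> ereal (k z)" by (rule order_trans[rotated])
      qed (use x in blast)
      then show ?thesis
        unfolding le_iff[OF \<theta>] x(2) using I_nonneg[OF \<theta>, of z] by (cases "I \<theta> z") auto
    qed
    ultimately show ?thesis
      unfolding k_def by (simp add: SUP_le_iff)
  qed
  have G_min: "\<exists>x\<in>X. min_over X (\<lambda>x. G x z) = G x z \<and> (\<forall>y\<in>X. G x z \<le> G y z)" for z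
  proof -
    have "continuous_on X (\<lambda>x. (x, z))" by (intro continuous_intros)
    from continuous_on_compose2[OF G_cont this] have "continuous_on X (\<lambda>x. G x z)" by auto
    from min_over_attained[OF X' this] show ?thesis by metis
  qed
  \<comment> \<open>The witness is a minimiser of \<open>G\<close> at \<open>z\<close>: there the
    penalized function at each \<theta> is at most \<open>G x z\<close>, which is the minimum
    itself.\<close>
  have "feasible X \<Theta> g l r Z \<phi> G"
    unfolding feasible_def m_def[symmetric]
    using G_cont risk_le_iff[OF _ G_cont] G_min G by metis

  \<comment> \<open>Optimality of \<open>G\<close>\<close>
  moreover have "min_over X (\<lambda>x. G x z) \<le> min_over X (\<lambda>x. H x z)"
    if H: "feasible X \<Theta> g l r Z \<phi> H" for H z
  proof -
    define c where "c = min_over X (\<lambda>x. H x z)"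
    have "\<exists>x\<in>X. ?p x z \<theta> \<le> ereal c" if "\<theta> \<in> \<Theta>" for \<theta>
      using H risk_le_iff[OF that, of H] that unfolding feasible_def m_def[symmetric] c_def by blast
    \<comment> \<open>Condition (I) at this fixed \<open>z\<close> supplies the finiteness premise
      of the minimax lemma, which then exchanges the quantifiers over \<theta> and
      \<open>x\<close>.\<close>
    moreover have "\<exists>\<theta>\<in>\<Theta>. penalty_inv l (I \<theta> z - ereal r) < \<infinity>"
    proof -
      obtain \<theta> where \<theta>: "\<theta> \<in> \<Theta>" "I \<theta> z < \<infinity>" using I_finite by blast
      then show ?thesis using I_nonneg[OF \<theta>(1), of z]
        by (intro bexI[of _ \<theta>]; cases "I \<theta> z") (auto simp: penalty_inv_simps[OF l])
    qed
    ultimately have "\<exists>x\<in>X. \<forall>\<theta>\<in>\<Theta>. ?p x z \<theta> \<le> ereal c"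
      using convex_concave_minimax[of X \<Theta> g "\<lambda>\<theta>. penalty_inv l (I \<theta> z - ereal r)" c,
          OF X' \<Theta>'(1) g_cont1 g_convex] concave[of _ z] usc_\<theta>[of _ _ z]
      unfolding penalized_def[abs_def] by blast
    then obtain x where x: "x \<in> X" "\<And>\<theta>. \<theta> \<in> \<Theta> \<Longrightarrow> ?p x z \<theta> \<le> ereal c" by blast
    then have "G x z \<le> c" using G[OF x(1), of z] by (metis ereal_less_eq(3))
    then show ?thesis using G_min[of z] x(1) unfolding c_def by fastforce
  qed
  ultimately show ?thesis using attains G by blast
qed

end
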